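(* Let $f:\mathbb{R}^n\to\mathbb{R}$ be $\nu$-smooth and $\mu$-strongly convex with $\inf_z f(z)=0$, let $X\in\mathbb{R}^{n\times p}$, and let $\Omega:\mathbb{R}^p\to\mathbb{R}\cup\{+\infty\}$ be proper, closed and convex. Let $\lambda_t>\lambda_{t+1}\ge\lambda>0$, let $\beta_t,\beta_{t+1}\in\operatorname{dom}\Omega$, and let $\theta_t,\theta_{t+1}$ be the associated rescaled dual feasible vectors $\theta_s=-\nabla f(X\beta_s)/\alpha_s$, with $\alpha_s\ge\lambda_s$, for $s\in\{t,t+1\}$. Suppose that the monotonicity condition $f(X\beta_{t+1})\le f(X\beta_t)$ holds. Then $$\mathrm{Gap}_{\lambda}(\beta_{t+1},\theta_{t+1})-\mathrm{Gap}_{\lambda}(\beta_t,\theta_t)\le \mathcal{E}_{t+1}-\mathcal{E}_t-\frac{\delta_t\,\|\zeta_t\|_2^2}{2\nu},$$ where $$\delta_t:=\left(1-\frac{\lambda}{\lambda_t}\right)^2-\left(\frac{\alpha_t\,\nu}{\lambda_t\,\mu}\right)^2\left(1-\frac{\lambda}{\lambda_{t+1}}\right)^2 .$$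
   Context: Norms on $\mathbb{R}^n$ are Euclidean. A differentiable function $f$ is $\nu$-smooth and $\mu$-strongly convex ($0<\mu\le\nu$) if for all $z,z_0$: $\frac{\mu}{2}\|z-z_0\|^2\le f(z)-f(z_0)-\langle\nabla f(z_0),z-z_0\rangle\le\frac{\nu}{2}\|z-z_0\|^2$. The Fenchel conjugate is $g^*(u)=\sup_{x}\langle u,x\rangle-g(x)$. For $\gamma>0$: primal objective $P_\gamma(\beta)=f(X\beta)+\gamma\,\Omega(\beta)$; dual objective $D_\gamma(\theta)=-f^*(-\gamma\theta)-\gamma\,\Omega^*(X^\top\theta)$; duality gap $\mathrm{Gap}_\gamma(\beta,\theta)=P_\gamma(\beta)-D_\gamma(\theta)$. For each index $s$, with regularization parameter $\lambda_s>0$ and primal vector $\beta_s$, the dual vector is $\theta_s=-\nabla f(X\beta_s)/\alpha_s$, where $\alpha_s\ge\lambda_s$ is a scalar making $\theta_s$ dual feasible, i.e. $\Omega^*(X^\top\theta_s)<+\infty$ (for $\Omega=\|\cdot\|_1$ one takes $\alpha_s=\max(\lambda_s,\|X^\top\nabla f(X\beta_s)\|_\infty)$). Further notation, for the fixed target parameter $\lambda$: $\zeta_s=-\lambda_s\theta_s$; $\mathrm{Gap}_s=\mathrm{Gap}_{\lambda_s}(\beta_s,\theta_s)$; $\Delta_s=f(X\beta_s)-f(\nabla f^*(\zeta_s))$; $\mathcal{E}_s=\mathcal{E}_s(\lambda)=\frac{\lambda}{\lambda_s}\mathrm{Gap}_s+\left(1-\frac{\lambda}{\lambda_s}\right)\Delta_s$.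 *)

theory Defs
  imports "HOL-Analysis.Analysis"
begin

definition grad :: "('a::euclidean_space \<Rightarrow> real) \<Rightarrow> 'a \<Rightarrow> 'a" where
  "grad f z = (THE D. GDERIV f z :> D)"

definition smooth_strongly_convex ::
  "real \<Rightarrow> real \<Rightarrow> ('a::euclidean_space \<Rightarrow> real) \<Rightarrow> bool" where
  "smooth_strongly_convex \<nu> \<mu> f \<longleftrightarrow>
     0 < \<mu> \<and> \<mu> \<le> \<nu> \<and>
     (\<forall>z. f differentiable (at z)) \<and>
     (\<forall>z z0. \<mu> / 2 * (norm (z - z0))\<^sup>2 \<le> f z - f z0 - grad f z0 \<bullet> (z - z0) \<and>
             f z - f z0 - grad f z0 \<bullet> (z - z0) \<le> \<nu> / 2 * (norm (z - z0))\<^sup>2)"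

text \<open>
  The library's \<^const>\<open>epigraph\<close> is for real-valued functions; closedness and convexity of
  an extended-real-valued function are those of the set below.
\<close>

definition epi :: "('a \<Rightarrow> ereal) \<Rightarrow> ('a \<times> real) set" where
  "epi g = {(x, r). g x \<le> ereal r}"

definition eff_dom :: "('a \<Rightarrow> ereal) \<Rightarrow> 'a set" where
  "eff_dom g = {x. g x < \<infinity>}"

definition proper :: "('a \<Rightarrow> ereal) \<Rightarrow> bool" where
  "proper g \<longleftrightarrow> (\<forall>x. g x \<noteq> -\<infinity>) \<and> eff_dom g \<noteq> {}"

definition fenchel_conjugate :: "('a::euclidean_space \<Rightarrow> ereal) \<Rightarrow> 'a \<Rightarrow> ereal" where
  "fenchel_conjugate g u = (SUP x. ereal (u \<bullet> x) - g x)"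

text \<open>
  The conjugate of a real-valued function is again extended-real-valued. For the gradient
  of the conjugate we pass to \<^const>\<open>real_of_ereal\<close>, which loses nothing for strongly convex
  functions, whose conjugate is finite everywhere.
\<close>

definition grad_conjugate :: "('a::euclidean_space \<Rightarrow> real) \<Rightarrow> 'a \<Rightarrow> 'a" where
  "grad_conjugate f = grad (\<lambda>u. real_of_ereal (fenchel_conjugate (\<lambda>z. ereal (f z)) u))"

text \<open>
  The objectives and the gap are extended-real-valued. At a primal point in the domain
  of \<open>\<Omega>\<close> and a dual feasible point (with \<open>\<Omega>\<close> proper and \<open>f\<close> strongly convex) all terms are
  finite, so no \<open>\<infinity> - \<infinity>\<close> arises.
\<close>

definition primal_obj ::
  "(real^'n \<Rightarrow> real) \<Rightarrow> real^'p^'n \<Rightarrow> (real^'p \<Rightarrow> ereal) \<Rightarrow> real \<Rightarrow> real^'p \<Rightarrow> ereal" where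
  "primal_obj f X \<Omega> \<gamma> \<beta> = ereal (f (X *v \<beta>)) + ereal \<gamma> * \<Omega> \<beta>"

definition dual_obj ::
  "(real^'n \<Rightarrow> real) \<Rightarrow> real^'p^'n \<Rightarrow> (real^'p \<Rightarrow> ereal) \<Rightarrow> real \<Rightarrow> real^'n \<Rightarrow> ereal" where
  "dual_obj f X \<Omega> \<gamma> \<theta> =
     - fenchel_conjugate (\<lambda>z. ereal (f z)) (- (\<gamma> *\<^sub>R \<theta>))
     - ereal \<gamma> * fenchel_conjugate \<Omega> (transpose X *v \<theta>)"

definition duality_gap ::
  "(real^'n \<Rightarrow> real) \<Rightarrow> real^'p^'n \<Rightarrow> (real^'p \<Rightarrow> ereal) \<Rightarrow> real \<Rightarrow>
   real^'p \<Rightarrow> real^'n \<Rightarrow> ereal" where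
  "duality_gap f X \<Omega> \<gamma> \<beta> \<theta> = primal_obj f X \<Omega> \<gamma> \<beta> - dual_obj f X \<Omega> \<gamma> \<theta>"

definition dual_feasible ::
  "real^'p^'n \<Rightarrow> (real^'p \<Rightarrow> ereal) \<Rightarrow> real^'n \<Rightarrow> bool" where
  "dual_feasible X \<Omega> \<theta> \<longleftrightarrow> fenchel_conjugate \<Omega> (transpose X *v \<theta>) < \<infinity>"

definition rescaled_dual ::
  "(real^'n \<Rightarrow> real) \<Rightarrow> real^'p^'n \<Rightarrow> real \<Rightarrow> real^'p \<Rightarrow> real^'n" where
  "rescaled_dual f X \<alpha> \<beta> = - (grad f (X *v \<beta>) /\<^sub>R \<alpha>)"

text \<open>
  In the remaining definitions \<open>l\<close> is the parameter \<open>\<lambda>\<^sub>s\<close> that belongs to \<open>\<beta> = \<beta>\<^sub>s\<close> and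
  \<open>\<theta> = \<theta>\<^sub>s\<close>, and \<open>lam\<close> is the target parameter \<open>\<lambda>\<close>.
\<close>

definition zeta :: "real \<Rightarrow> real^'n \<Rightarrow> real^'n" where
  "zeta l \<theta> = - (l *\<^sub>R \<theta>)"

definition Delta ::
  "(real^'n \<Rightarrow> real) \<Rightarrow> real^'p^'n \<Rightarrow> real \<Rightarrow> real^'p \<Rightarrow> real^'n \<Rightarrow> real" where
  "Delta f X l \<beta> \<theta> = f (X *v \<beta>) - f (grad_conjugate f (zeta l \<theta>))"

definition calE ::
  "(real^'n \<Rightarrow> real) \<Rightarrow> real^'p^'n \<Rightarrow> (real^'p \<Rightarrow> ereal) \<Rightarrow> real \<Rightarrow> real \<Rightarrow>
   real^'p \<Rightarrow> real^'n \<Rightarrow> ereal" where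
  "calE f X \<Omega> lam l \<beta> \<theta> =
     ereal (lam / l) * duality_gap f X \<Omega> l \<beta> \<theta> + ereal ((1 - lam / l) * Delta f X l \<beta> \<theta>)"

end

theory Submission
  imports Defs
begin

text \<open>
  The difference \<open>Gap\<^sub>\<lambda>(\<beta>\<^sub>s, \<theta>\<^sub>s) - \<E>\<^sub>s\<close> is the Bregman divergence of \<open>f\<^sup>*\<close> between
  \<open>(\<lambda> / \<lambda>\<^sub>s) \<zeta>\<^sub>s\<close> and \<open>\<zeta>\<^sub>s\<close>: the \<open>\<Omega>\<close>-terms and \<open>f(X\<beta>\<^sub>s)\<close> cancel. It lies between
  \<open>(1 - \<lambda> / \<lambda>\<^sub>s)\<^sup>2 \<parallel>\<zeta>\<^sub>s\<parallel>\<^sup>2 / (2\<nu>)\<close> and \<open>(1 - \<lambda> / \<lambda>\<^sub>s)\<^sup>2 \<parallel>\<zeta>\<^sub>s\<parallel>\<^sup>2 / (2\<mu>)\<close>.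
  As \<open>inf f = 0\<close>, we have \<open>2\<mu> f \<le> \<parallel>\<nabla>f\<parallel>\<^sup>2 \<le> 2\<nu> f\<close>, so the monotonicity condition bounds
  \<open>\<parallel>\<zeta>\<^sub>t\<^sub>+\<^sub>1\<parallel>\<close> by a multiple of \<open>\<parallel>\<zeta>\<^sub>t\<parallel>\<close>.
\<close>

section \<open>Quadratic inequalities and surjectivity of the gradient\<close>

lemma smooth_strongly_convexD:
  assumes "smooth_strongly_convex \<nu> \<mu> f"
  shows "0 < \<mu>" "0 < \<nu>"
    and "f z0 + grad f z0 \<bullet> (z - z0) + \<mu> / 2 * (norm (z - z0))\<^sup>2 \<le> f z"
    and "f z \<le> f z0 + grad f z0 \<bullet> (z - z0) + \<nu> / 2 * (norm (z - z0))\<^sup>2"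
proof -
  show "0 < \<mu>" "0 < \<nu>"
    using assms by (auto simp: smooth_strongly_convex_def)
  have "\<mu> / 2 * (norm (z - z0))\<^sup>2 \<le> f z - f z0 - grad f z0 \<bullet> (z - z0)"
    and "f z - f z0 - grad f z0 \<bullet> (z - z0) \<le> \<nu> / 2 * (norm (z - z0))\<^sup>2"
    using assms unfolding smooth_strongly_convex_def by blast+
  then show "f z0 + grad f z0 \<bullet> (z - z0) + \<mu> / 2 * (norm (z - z0))\<^sup>2 \<le> f z"
    and "f z \<le> f z0 + grad f z0 \<bullet> (z - z0) + \<nu> / 2 * (norm (z - z0))\<^sup>2"
    by linarith+
qed

text \<open>Young's inequality. With \<open>c\<close> equal to \<mu> the second square cancels the
  quadratic term of strong convexity.\<close>

lemma inner_le_weighted_squares: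
  fixes u v :: "'a::real_inner"
  assumes "0 < c"
  shows "u \<bullet> v \<le> (norm u)\<^sup>2 / (2 * c) + c / 2 * (norm v)\<^sup>2"
proof -
  have "0 \<le> (norm (u - c *\<^sub>R v))\<^sup>2 / (2 * c)"
    using assms by simp
  also have "\<dots> = (norm u)\<^sup>2 / (2 * c) + c / 2 * (norm v)\<^sup>2 - u \<bullet> v"
    using assms unfolding power2_norm_eq_inner
    by (simp add: inner_diff_left inner_diff_right inner_commute field_simps)
  finally show ?thesis by linarith
qed

text \<open>A gradient step of length 1/\<nu> for the tilted function
  \<open>f z - u \<bullet> z\<close>; the step minimises its quadratic upper model at
  \<open>z\<close>. The case \<open>u = 0\<close> bounds the gradient, and general \<open>u\<close>
  is what the study of the conjugate uses.\<close>

lemma smooth_descent_step: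
  assumes "smooth_strongly_convex \<nu> \<mu> f"
  shows "f (z + (u - grad f z) /\<^sub>R \<nu>) - u \<bullet> (z + (u - grad f z) /\<^sub>R \<nu>)
         \<le> f z - u \<bullet> z - (norm (u - grad f z))\<^sup>2 / (2 * \<nu>)"
proof -
  define d where "d = u - grad f z"
  have pos: "0 < \<nu>"
    using smooth_strongly_convexD(2)[OF assms] .
  have g: "grad f z = u - d"
    by (simp add: d_def)
  have "f (z + d /\<^sub>R \<nu>) \<le> f z + (u - d) \<bullet> (d /\<^sub>R \<nu>) + \<nu> / 2 * (norm (d /\<^sub>R \<nu>))\<^sup>2"
    using smooth_strongly_convexD(4)[OF assms, of "z + d /\<^sub>R \<nu>" z] by (simp add: g)
  also have "\<dots> = f z + u \<bullet> (d /\<^sub>R \<nu>) - (norm d)\<^sup>2 / (2 * \<nu>)"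
    using pos unfolding power2_norm_eq_inner
    by (simp add: inner_diff_left field_simps power2_eq_square)
  finally show ?thesis
    unfolding d_def[symmetric] by (simp add: inner_add_right)
qed

lemma smooth_grad_bound:
  assumes f: "smooth_strongly_convex \<nu> \<mu> f" and lb: "\<And>z. m \<le> f z"
  shows "(norm (grad f z))\<^sup>2 \<le> 2 * \<nu> * (f z - m)"
proof -
  have "m \<le> f z - (norm (grad f z))\<^sup>2 / (2 * \<nu>)"
    using smooth_descent_step[OF f, of z 0] lb[of "z + (0 - grad f z) /\<^sub>R \<nu>"] by simp
  then show ?thesis
    using smooth_strongly_convexD(2)[OF f] by (simp add: field_simps)
qed

text \<open>Young's inequality absorbs the linear term of strong convexity. The point
  \<open>y\<close> is arbitrary, so the infimum can be taken over it afterwards.\<close>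

lemma polyak_lojasiewicz:
  assumes f: "smooth_strongly_convex \<nu> \<mu> f"
  shows "2 * \<mu> * (f z - f y) \<le> (norm (grad f z))\<^sup>2"
proof -
  have pos: "0 < \<mu>"
    using smooth_strongly_convexD(1)[OF f] .
  have "- grad f z \<bullet> (y - z) \<le> (norm (grad f z))\<^sup>2 / (2 * \<mu>) + \<mu> / 2 * (norm (y - z))\<^sup>2"
    using inner_le_weighted_squares[OF pos, of "- grad f z" "y - z"] by simp
  then have "f z - f y \<le> (norm (grad f z))\<^sup>2 / (2 * \<mu>)"
    using smooth_strongly_convexD(3)[OF f, of z y] by simp
  then show ?thesis
    using pos by (simp add: field_simps)
qed

text \<open>Strong convexity makes the tilted function \<open>f z - u \<bullet> z\<close> attain its
  minimum; a descent step from the minimiser cannot decrease it, which forces its gradient to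
  vanish.\<close>

lemma surj_grad:
  fixes f :: "'a::euclidean_space \<Rightarrow> real"
  assumes f: "smooth_strongly_convex \<nu> \<mu> f"
  obtains x where "grad f x = u"
proof -
  define g where "g = (\<lambda>z. f z - u \<bullet> z)"
  \<comment> \<open>Beyond this radius the quadratic term of strong convexity at 0 outweighs the
    linear term, so \<open>g\<close> is at least \<open>g 0\<close> there.\<close>
  define R where "R = 2 * norm (grad f 0 - u) / \<mu>"
  have pos: "0 < \<mu>" "0 < \<nu>"
    using smooth_strongly_convexD(1,2)[OF f] .
  have R: "0 \<le> R"
    using pos unfolding R_def by (intro divide_nonneg_pos) auto
  have "isCont f z" for z
    using f by (simp add: smooth_strongly_convex_def differentiable_imp_continuous_within)
  then have "continuous_on (cball 0 R) g"
    unfolding g_def by (intro continuous_intros continuous_at_imp_continuous_on) auto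
  moreover have "cball (0::'a) R \<noteq> {}"
    using R by simp
  ultimately obtain x where x: "x \<in> cball 0 R" "\<And>z. z \<in> cball 0 R \<Longrightarrow> g x \<le> g z"
    using continuous_attains_inf[of "cball 0 R" g] by auto
  have min: "g x \<le> g z" for z
  proof (cases "z \<in> cball 0 R")
    case False
    then have "norm (grad f 0 - u) \<le> \<mu> / 2 * norm z"
      using pos by (simp add: R_def field_simps)
    then have "norm (grad f 0 - u) * norm z \<le> \<mu> / 2 * (norm z)\<^sup>2"
      using mult_right_mono[OF _ norm_ge_zero[of z]] by (fastforce simp: power2_eq_square mult.assoc)
    moreover have "- (norm (grad f 0 - u) * norm z) \<le> (grad f 0 - u) \<bullet> z"
      using Cauchy_Schwarz_ineq2[of "grad f 0 - u" z] by linarith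
    ultimately have "g 0 \<le> g z"
      using smooth_strongly_convexD(3)[OF f, of 0 z] by (simp add: g_def inner_diff_left)
    moreover have "g x \<le> g 0"
      using x(2)[of 0] R by simp
    ultimately show ?thesis by linarith
  qed (rule x(2))
  have "(norm (u - grad f x))\<^sup>2 / (2 * \<nu>) \<le> 0"
    using smooth_descent_step[OF f, of x u] min[of "x + (u - grad f x) /\<^sub>R \<nu>"]
    by (simp add: g_def)
  then have "grad f x = u"
    using pos by (simp add: divide_le_0_iff)
  then show thesis by (rule that)
qed

text \<open>A quadratic remainder divided by \<open>norm (v - u)\<close> tends to 0, so
  \<open>x\<close> is a gradient; uniqueness of the derivative then settles the definite description
  in \<open>grad\<close>.\<close>

lemma grad_eqI:
  fixes h :: "'a::euclidean_space \<Rightarrow> real"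
  assumes bound: "\<And>v. \<bar>h v - h u - x \<bullet> (v - u)\<bar> \<le> C * (norm (v - u))\<^sup>2"
  shows "grad h u = x"
proof -
  have "((\<lambda>v. (1 / norm (v - u)) *\<^sub>R (h v - (h u + (v - u) \<bullet> x))) \<longlongrightarrow> 0) (at u)"
  proof (rule Lim_null_comparison)
    show "\<forall>\<^sub>F v in at u. norm ((1 / norm (v - u)) *\<^sub>R (h v - (h u + (v - u) \<bullet> x))) \<le> C * norm (v - u)"
    proof (rule eventually_at_filter[THEN iffD2], rule always_eventually, intro allI impI)
      fix v assume "v \<noteq> u"
      then show "norm ((1 / norm (v - u)) *\<^sub>R (h v - (h u + (v - u) \<bullet> x))) \<le> C * norm (v - u)"
        using bound[of v] by (simp add: field_simps power2_eq_square inner_commute)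
    qed
    have "((\<lambda>v. C * norm (v - u)) \<longlongrightarrow> C * norm (u - u)) (at u)"
      by (intro tendsto_intros)
    then show "((\<lambda>v. C * norm (v - u)) \<longlongrightarrow> 0) (at u)" by simp
  qed
  then have "GDERIV h u :> x"
    unfolding gderiv_def has_derivative_within
    by (simp add: bounded_linear_inner_left)
  moreover have "D = x" if "GDERIV h u :> D" for D
  proof -
    have "(\<lambda>k. k \<bullet> D) = (\<lambda>k. k \<bullet> x)"
      using that \<open>GDERIV h u :> x\<close> unfolding gderiv_def by (rule has_derivative_unique)
    then show ?thesis
      by (metis inner_commute vector_eq_rdot)
  qed
  ultimately show ?thesis
    unfolding grad_def by (rule the_equality)
qed

section \<open>The conjugate and its Bregman divergence\<close>

text \<open>Equality in the Fenchel-Young inequality: \<open>f\<close> lies above its tangent at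
  \<open>x\<close>, so \<open>x\<close> attains the supremum.\<close>

lemma fenchel_conjugate_at_grad:
  assumes f: "smooth_strongly_convex \<nu> \<mu> f"
  shows "fenchel_conjugate (\<lambda>z. ereal (f z)) (grad f x) = ereal (grad f x \<bullet> x - f x)"
  unfolding fenchel_conjugate_def
proof (rule antisym)
  show "(SUP z. ereal (grad f x \<bullet> z) - ereal (f z)) \<le> ereal (grad f x \<bullet> x - f x)"
  proof (rule SUP_least)
    fix z
    have "0 \<le> \<mu> / 2 * (norm (z - x))\<^sup>2"
      using smooth_strongly_convexD(1)[OF f] by simp
    then show "ereal (grad f x \<bullet> z) - ereal (f z) \<le> ereal (grad f x \<bullet> x - f x)"
      using smooth_strongly_convexD(3)[OF f, of x z] by (simp add: inner_diff_right)
  qed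
  show "ereal (grad f x \<bullet> x - f x) \<le> (SUP z. ereal (grad f x \<bullet> z) - ereal (f z))"
    by (rule SUP_upper2[of x]) auto
qed

definition conj_real :: "('a::euclidean_space \<Rightarrow> real) \<Rightarrow> 'a \<Rightarrow> real" where
  "conj_real f u = real_of_ereal (fenchel_conjugate (\<lambda>z. ereal (f z)) u)"

lemma conj_real_at_grad:
  assumes "smooth_strongly_convex \<nu> \<mu> f"
  shows "conj_real f (grad f x) = grad f x \<bullet> x - f x"
  by (simp add: conj_real_def fenchel_conjugate_at_grad[OF assms])

lemma fenchel_conjugate_eq_conj_real:
  assumes "smooth_strongly_convex \<nu> \<mu> f"
  shows "fenchel_conjugate (\<lambda>z. ereal (f z)) u = ereal (conj_real f u)"
  using surj_grad[OF assms, of u] fenchel_conjugate_at_grad[OF assms] conj_real_at_grad[OF assms]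
  by metis

text \<open>The conjugate is 1/\<nu>-strongly convex and 1/\<mu>-smooth. Here \<open>x\<close>
  stands in for its gradient at \<open>grad f x\<close>, which is identified only afterwards, from
  these very bounds.\<close>

lemma conj_real_bregman_bounds:
  assumes f: "smooth_strongly_convex \<nu> \<mu> f"
  defines "B \<equiv> \<lambda>v x. conj_real f v - conj_real f (grad f x) - x \<bullet> (v - grad f x)"
  shows "(norm (v - grad f x))\<^sup>2 / (2 * \<nu>) \<le> B v x"
    and "B v x \<le> (norm (v - grad f x))\<^sup>2 / (2 * \<mu>)"
proof -
  obtain y where y: "grad f y = v"
    using surj_grad[OF f] .
  have pos: "0 < \<mu>"
    using smooth_strongly_convexD(1)[OF f] .
  \<comment> \<open>The divergence is the drop of the tilted function
    \<open>f z - v \<bullet> z\<close> from \<open>x\<close> to its minimiser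
    \<open>y\<close>.\<close>
  have B: "B v x = (f x - v \<bullet> x) - (f y - v \<bullet> y)"
    unfolding B_def y[symmetric] conj_real_at_grad[OF f]
    by (simp add: inner_diff_right inner_commute)
  \<comment> \<open>One descent step from \<open>x\<close> already realises the claimed drop, and
    the minimiser \<open>y\<close> lies no higher than \<open>w\<close>.\<close>
  define w where "w = x + (v - grad f x) /\<^sub>R \<nu>"
  have "f y + v \<bullet> (w - y) \<le> f w"
    using smooth_strongly_convexD(3)[OF f, of y w] pos by (smt (verit) mult_nonneg_nonneg
        half_gt_zero y zero_le_power2)
  then show "(norm (v - grad f x))\<^sup>2 / (2 * \<nu>) \<le> B v x"
    using smooth_descent_step[OF f, of x v] unfolding B w_def[symmetric]
    by (simp add: inner_diff_right)
  show "B v x \<le> (norm (v - grad f x))\<^sup>2 / (2 * \<mu>)"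
    using smooth_strongly_convexD(3)[OF f, of x y]
      inner_le_weighted_squares[OF pos, of "v - grad f x" "y - x"]
    unfolding B by (simp add: inner_diff_right inner_diff_left)
qed

lemma grad_conjugate_grad:
  assumes f: "smooth_strongly_convex \<nu> \<mu> f"
  shows "grad_conjugate f (grad f x) = x"
proof -
  have "grad (conj_real f) (grad f x) = x"
  proof (rule grad_eqI)
    fix v
    have "0 \<le> (norm (v - grad f x))\<^sup>2 / (2 * \<nu>)"
      using smooth_strongly_convexD(2)[OF f] by simp
    then show "\<bar>conj_real f v - conj_real f (grad f x) - x \<bullet> (v - grad f x)\<bar>
        \<le> 1 / (2 * \<mu>) * (norm (v - grad f x))\<^sup>2"
      using conj_real_bregman_bounds[OF f, where v = v and x = x] by simp
  qed
  then show ?thesis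
    by (simp add: grad_conjugate_def conj_real_def[abs_def])
qed

lemma fenchel_conjugate_finite:
  assumes "proper g" "fenchel_conjugate g u < \<infinity>"
  shows "\<bar>fenchel_conjugate g u\<bar> \<noteq> \<infinity>"
proof -
  obtain x where x: "g x \<noteq> \<infinity>" "g x \<noteq> -\<infinity>"
    using assms(1) by (auto simp: proper_def eff_dom_def)
  have "-\<infinity> < ereal (u \<bullet> x) - g x"
    using x by (cases "g x") auto
  also have "\<dots> \<le> fenchel_conjugate g u"
    unfolding fenchel_conjugate_def by (rule SUP_upper) simp
  finally show ?thesis
    using assms(2) by auto
qed

section \<open>Comparison of the gaps\<close>

lemma gap_minus_calE:
  assumes f: "smooth_strongly_convex \<nu> \<mu> f"
    and \<Omega>: "proper \<Omega>" "\<beta> \<in> eff_dom \<Omega>" "dual_feasible X \<Omega> \<theta>"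
    and l: "0 < l"
  obtains G E B where
    "duality_gap f X \<Omega> lam \<beta> \<theta> = ereal G" "calE f X \<Omega> lam l \<beta> \<theta> = ereal E"
    "G = E + B"
    "(1 - lam / l)\<^sup>2 * (norm (zeta l \<theta>))\<^sup>2 / (2 * \<nu>) \<le> B"
    "B \<le> (1 - lam / l)\<^sup>2 * (norm (zeta l \<theta>))\<^sup>2 / (2 * \<mu>)"
proof -
  obtain a where a: "\<Omega> \<beta> = ereal a"
    using \<Omega>(1,2) by (cases "\<Omega> \<beta>") (auto simp: proper_def eff_dom_def)
  obtain b where b: "fenchel_conjugate \<Omega> (transpose X *v \<theta>) = ereal b"
    using fenchel_conjugate_finite[OF \<Omega>(1) \<Omega>(3)[unfolded dual_feasible_def]]
    by (cases "fenchel_conjugate \<Omega> (transpose X *v \<theta>)") auto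
  \<comment> \<open>This \<open>x\<close> is the gradient of the conjugate at
    \<open>zeta l \<theta>\<close>, the point that occurs in \<open>Delta\<close>.\<close>
  obtain x where x: "grad f x = zeta l \<theta>"
    using surj_grad[OF f] .
  define B where "B = conj_real f (- (lam *\<^sub>R \<theta>)) - conj_real f (zeta l \<theta>)
    - x \<bullet> (- (lam *\<^sub>R \<theta>) - zeta l \<theta>)"
  define gap where "gap = (\<lambda>c. f (X *v \<beta>) + c * a + conj_real f (- (c *\<^sub>R \<theta>)) + c * b)"
  have gap: "duality_gap f X \<Omega> c \<beta> \<theta> = ereal (gap c)" for c
    by (simp add: duality_gap_def primal_obj_def dual_obj_def gap_def a b[simplified]
        fenchel_conjugate_eq_conj_real[OF f] algebra_simps)
  define E where "E = lam / l * gap l + (1 - lam / l) * (f (X *v \<beta>) - f x)"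
  have "grad_conjugate f (zeta l \<theta>) = x"
    using grad_conjugate_grad[OF f, of x] x by simp
  then have E: "calE f X \<Omega> lam l \<beta> \<theta> = ereal E"
    by (simp add: calE_def Delta_def gap E_def)
  \<comment> \<open>The Fenchel-Young equality trades the primal value in \<open>Delta\<close> for a
    conjugate value, so that only conjugate terms remain in the divergence.\<close>
  have fx: "f x = zeta l \<theta> \<bullet> x - conj_real f (zeta l \<theta>)"
    using conj_real_at_grad[OF f, of x] x by simp
  have zeta_diff: "- (lam *\<^sub>R \<theta>) - zeta l \<theta> = (lam / l - 1) *\<^sub>R zeta l \<theta>"
    using l by (simp add: zeta_def algebra_simps)
  have "lam / l * gap l = lam / l * (f (X *v \<beta>) + conj_real f (zeta l \<theta>)) + lam * a + lam * b"
    using l by (simp add: gap_def zeta_def field_simps)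
  then have GB: "gap lam = E + B"
    unfolding E_def B_def fx zeta_diff
    by (simp add: gap_def inner_commute algebra_simps)
  have "(norm (- (lam *\<^sub>R \<theta>) - zeta l \<theta>))\<^sup>2 = (1 - lam / l)\<^sup>2 * (norm (zeta l \<theta>))\<^sup>2"
    unfolding zeta_diff by (simp add: power_mult_distrib power2_commute)
  then show thesis
    using that[OF gap E GB]
      conj_real_bregman_bounds[OF f, where v = "- (lam *\<^sub>R \<theta>)" and x = x]
    unfolding x B_def[symmetric] by simp
qed

theorem lemma2:
  fixes f :: "real^'n \<Rightarrow> real"
    and X :: "real^'p^'n"
    and \<Omega> :: "real^'p \<Rightarrow> ereal"
    and \<nu> \<mu> lam \<delta> :: real
    and l \<alpha> :: "nat \<Rightarrow> real"
    and \<beta> :: "nat \<Rightarrow> real^'p"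
    and \<theta> :: "nat \<Rightarrow> real^'n"
    and t :: nat
  assumes f: "smooth_strongly_convex \<nu> \<mu> f"
    and inf_f: "(INF z. ereal (f z)) = 0"
    and \<Omega>: "proper \<Omega>" "closed (epi \<Omega>)" "convex (epi \<Omega>)"
    and l: "l t > l (t + 1)" "l (t + 1) \<ge> lam" "lam > 0"
    and \<beta>: "\<forall>s\<in>{t, t + 1}. \<beta> s \<in> eff_dom \<Omega>"
    and \<theta>: "\<forall>s\<in>{t, t + 1}. \<alpha> s \<ge> l s \<and> \<theta> s = rescaled_dual f X (\<alpha> s) (\<beta> s)
              \<and> dual_feasible X \<Omega> (\<theta> s)"
    and mono: "f (X *v \<beta> (t + 1)) \<le> f (X *v \<beta> t)"
    and \<delta>: "\<delta> = (1 - lam / l t)\<^sup>2 - (\<alpha> t * \<nu> / (l t * \<mu>))\<^sup>2 * (1 - lam / l (t + 1))\<^sup>2"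
  shows "duality_gap f X \<Omega> lam (\<beta> (t + 1)) (\<theta> (t + 1)) - duality_gap f X \<Omega> lam (\<beta> t) (\<theta> t)
       \<le> calE f X \<Omega> lam (l (t + 1)) (\<beta> (t + 1)) (\<theta> (t + 1))
         - calE f X \<Omega> lam (l t) (\<beta> t) (\<theta> t)
         - ereal (\<delta> * (norm (zeta (l t) (\<theta> t)))\<^sup>2 / (2 * \<nu>))"
proof -
  have pos: "0 < \<mu>" "0 < \<nu>" and lpos: "0 < l t" "0 < l (t + 1)"
    using smooth_strongly_convexD(1,2)[OF f] l by linarith+
  have f_nonneg: "0 \<le> f z" for z
    using INF_lower[of z UNIV "\<lambda>z. ereal (f z)"] inf_f by simp
  have zeta: "zeta (l s) (\<theta> s) = (l s / \<alpha> s) *\<^sub>R grad f (X *v \<beta> s)" if "s \<in> {t, t + 1}" for s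
    using \<theta> that by (auto simp: zeta_def rescaled_dual_def divide_inverse)
  have \<alpha>: "l t \<le> \<alpha> t" "l (t + 1) \<le> \<alpha> (t + 1)"
    using \<theta> by auto
  define g where "g = (\<lambda>s. (norm (grad f (X *v \<beta> s)))\<^sup>2)"
  \<comment> \<open>Only \<open>l (t + 1) / \<alpha> (t + 1) \<le> 1\<close> is used at this index,
    which is why \<delta> contains no \<open>\<alpha> (t + 1)\<close>.\<close>
  have "norm (zeta (l (t + 1)) (\<theta> (t + 1))) \<le> 1 * norm (grad f (X *v \<beta> (t + 1)))"
    unfolding zeta[of "t + 1", OF insertI2[OF insertI1]] norm_scaleR
    by (rule mult_right_mono) (use \<alpha> lpos in auto)
  then have "(norm (zeta (l (t + 1)) (\<theta> (t + 1))))\<^sup>2 \<le> g (t + 1)"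
    unfolding g_def by (simp add: power_mono)
  also have "\<dots> \<le> 2 * \<nu> * f (X *v \<beta> (t + 1))"
    using smooth_grad_bound[OF f f_nonneg] by (simp add: g_def)
  also have "\<dots> \<le> 2 * \<nu> * f (X *v \<beta> t)"
    using mono pos by simp
  also have "f (X *v \<beta> t) \<le> g t / (2 * \<mu>)"
  proof -
    have "ereal (f (X *v \<beta> t) - g t / (2 * \<mu>)) \<le> (INF z. ereal (f z))"
    proof (rule INF_greatest)
      fix z
      show "ereal (f (X *v \<beta> t) - g t / (2 * \<mu>)) \<le> ereal (f z)"
        using polyak_lojasiewicz[OF f, of "X *v \<beta> t" z] pos by (simp add: g_def field_simps)
    qed
    then show ?thesis
      using inf_f by simp
  qed
  \<comment> \<open>At index \<open>t\<close> the rescaling is undone exactly; this puts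
    \<open>\<alpha> t / l t\<close> into \<delta>.\<close>
  also have "g t = (\<alpha> t / l t)\<^sup>2 * (norm (zeta (l t) (\<theta> t)))\<^sup>2"
    using \<alpha> lpos zeta[of t] by (simp add: g_def power_mult_distrib power_divide)
  finally have zeta_bound: "(norm (zeta (l (t + 1)) (\<theta> (t + 1))))\<^sup>2
      \<le> \<nu> / \<mu> * (\<alpha> t / l t)\<^sup>2 * (norm (zeta (l t) (\<theta> t)))\<^sup>2"
    using pos by simp
  have dom: "\<beta> t \<in> eff_dom \<Omega>" "\<beta> (t + 1) \<in> eff_dom \<Omega>"
    and feas: "dual_feasible X \<Omega> (\<theta> t)" "dual_feasible X \<Omega> (\<theta> (t + 1))"
    using \<beta> \<theta> by auto
  obtain G E B where t: "duality_gap f X \<Omega> lam (\<beta> t) (\<theta> t) = ereal G"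
    "calE f X \<Omega> lam (l t) (\<beta> t) (\<theta> t) = ereal E" "G = E + B"
    "(1 - lam / l t)\<^sup>2 * (norm (zeta (l t) (\<theta> t)))\<^sup>2 / (2 * \<nu>) \<le> B"
    using gap_minus_calE[OF f \<Omega>(1) dom(1) feas(1) lpos(1), of lam] by blast
  obtain G' E' B' where t': "duality_gap f X \<Omega> lam (\<beta> (t + 1)) (\<theta> (t + 1)) = ereal G'"
    "calE f X \<Omega> lam (l (t + 1)) (\<beta> (t + 1)) (\<theta> (t + 1)) = ereal E'" "G' = E' + B'"
    "B' \<le> (1 - lam / l (t + 1))\<^sup>2 * (norm (zeta (l (t + 1)) (\<theta> (t + 1))))\<^sup>2 / (2 * \<mu>)"
    using gap_minus_calE[OF f \<Omega>(1) dom(2) feas(2) lpos(2), of lam] by blast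
  note t'(4)
  also have "(1 - lam / l (t + 1))\<^sup>2 * (norm (zeta (l (t + 1)) (\<theta> (t + 1))))\<^sup>2 / (2 * \<mu>)
      \<le> (1 - lam / l (t + 1))\<^sup>2 * (\<nu> / \<mu> * (\<alpha> t / l t)\<^sup>2 * (norm (zeta (l t) (\<theta> t)))\<^sup>2) / (2 * \<mu>)"
    using zeta_bound pos by (intro divide_right_mono mult_left_mono) auto
  \<comment> \<open>The factor \<nu>/\<mu> of \<open>zeta_bound\<close>, divided by 2\<mu>, is the
    square of \<nu>/\<mu> divided by 2\<nu>; both divergence bounds now share the denominator
    2\<nu>.\<close>
  also have "\<dots> = (\<alpha> t * \<nu> / (l t * \<mu>))\<^sup>2 * (1 - lam / l (t + 1))\<^sup>2
      * (norm (zeta (l t) (\<theta> t)))\<^sup>2 / (2 * \<nu>)"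
    using pos by (simp add: power2_eq_square mult_ac)
  finally have "B' - B \<le> - (\<delta> * (norm (zeta (l t) (\<theta> t)))\<^sup>2 / (2 * \<nu>))"
    using t(4) unfolding \<delta> by (simp add: left_diff_distrib diff_divide_distrib)
  then show ?thesis
    unfolding t(1,2) t'(1,2) using t(3) t'(3) by simp
qed

end
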